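(* As formal power series in $q$ (equivalently, for complex $q$ with $|q|<1$), $$\sum_{n\ge 0}\frac{q^{2n^2+n}}{(q;q)_{2n+1}}=\frac{1}{(q;q)_\infty}\sum_{k\in\mathbb{Z}}(-1)^kq^{3k^2-k}=\frac{(q^2;q^2)_\infty}{(q;q)_\infty}=(-q;q)_\infty .$$
   Context: $(z;q)_n=\prod_{j=0}^{n-1}(1-q^jz)$ and $(z;q)_\infty=\prod_{j\ge0}(1-q^jz)$; thus $(q;q)_\infty=\prod_{j\ge1}(1-q^j)$, $(q^2;q^2)_\infty=\prod_{j\ge1}(1-q^{2j})$, $(-q;q)_\infty=\prod_{j\ge1}(1+q^j)$. *)

theory Defs
  imports
    "HOL-Analysis.Analysis"
    "HOL-Computational_Algebra.Formal_Power_Series"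
begin

text \<open>
  The \<open>q\<close>-Pochhammer symbols \<open>(z; q)\<^sub>n\<close> and \<open>(z; q)\<^sub>\<infinity>\<close>. They are used both for complex numbers and
  for formal power series. Limits of formal power series refer to the library's metric on
  \<^typ>\<open>'a fps\<close>, which induces the \<open>X\<close>-adic topology (coefficientwise stabilisation).
\<close>

definition qpoch :: "'a::comm_ring_1 \<Rightarrow> 'a \<Rightarrow> nat \<Rightarrow> 'a" where
  "qpoch z q n = (\<Prod>j<n. 1 - q ^ j * z)"

text \<open>
  \<^const>\<open>prodinf\<close> is meaningful only if the product converges in the sense of
  \<^const>\<open>convergent_prod\<close>.
\<close>

definition qpoch_inf :: "'a::{comm_ring_1, t2_space} \<Rightarrow> 'a \<Rightarrow> 'a" where
  "qpoch_inf z q = prodinf (\<lambda>j. 1 - q ^ j * z)"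

end

theory Submission
  imports Defs
begin

text \<open>
  Both \<open>\<complex>\<close> and the ring of formal power series (with \<open>N f = 2 ^ (- subdegree f)\<close>) are complete with
  respect to a multiplicative norm \<open>N\<close> with \<open>N q < 1\<close>, so both cases are treated at once.

  Put \<open>b\<^sub>m = q\<^bsup>m(m+1)/2\<^esup> / (q; q)\<^sub>m\<close>. Then \<open>q\<^bsup>2n\<^sup>2+n\<^esup> / (q; q)\<^bsub>2n+1\<^esub> = b\<^bsub>2n\<^esub> + b\<^bsub>2n+1\<^esub>\<close>, so the left-hand side is
  Euler's series \<open>\<Sum> b\<^sub>m\<close>. With \<open>F\<^sub>k = \<Sum> q\<^bsup>km\<^esup> b\<^sub>m\<close> one has \<open>F\<^sub>k = (1 + q\<^bsup>k+1\<^esup>) F\<^bsub>k+1\<^esub>\<close> and \<open>F\<^sub>k \<longlonglongrightarrow> 1\<close>, whence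
  \<open>F\<^sub>0 = (-q; q)\<^sub>\<infinity>\<close>. The theta series equals \<open>(q\<^sup>2; q\<^sup>2)\<^sub>\<infinity>\<close> by Shanks' finite form of the pentagonal number
  theorem.
\<close>

section \<open>Exact division by units\<close>

text \<open>In an \<open>idom_divide\<close>, \<open>div\<close> is specified only on exact
  multiples; for a unit \<open>u\<close> with cofactor \<open>w\<close>, every \<open>a\<close> is
  the multiple \<open>u * (a * w)\<close>, so \<open>a div u\<close> is
  \<open>a * w\<close>.\<close>

lemma unit_div:
  fixes u :: "'a::idom_divide"
  assumes "u dvd 1"
  shows "u * (a div u) = a" "a * (1 div u) = a div u"
proof -
  obtain w where w: "1 = u * w"
    using assms by (rule dvdE)
  then have u: "u \<noteq> 0"
    by auto
  have "a div u = a * w" for a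
    using nonzero_mult_div_cancel_left[OF u, of "a * w"] w by (metis mult.left_commute mult.right_neutral)
  then show "u * (a div u) = a" "a * (1 div u) = a div u"
    using w by (simp_all add: mult.left_commute)
qed

section \<open>Multiplicative norms on integral domains\<close>

text \<open>The class is \<open>idom_divide\<close> rather than a field because nonzero formal power
  series need not be invertible. Definiteness, symmetry and the triangle inequality for
  \<open>N\<close> are inherited from the metric.\<close>

locale multiplicative_norm =
  fixes N :: "'a::{idom_divide, complete_space} \<Rightarrow> real"
  assumes dist_N: "dist x y = N (x - y)"
    and N_mult: "N (x * y) = N x * N y"
begin

lemma N_0 [simp]: "N 0 = 0"
  using dist_N[of 0 0] by simp

lemma N_eq_0_iff [simp]: "N x = 0 \<longleftrightarrow> x = 0"
  using dist_N[of x 0] by (metis diff_zero dist_eq_0_iff)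

lemma N_nonneg [simp]: "N x \<ge> 0"
  using dist_N[of x 0] by (metis diff_zero zero_le_dist)

lemma N_1 [simp]: "N 1 = 1"
  using N_mult[of 1 1] by simp

lemma N_minus [simp]: "N (- x) = N x"
  using dist_N[of x 0] dist_N[of 0 x] by (simp add: dist_commute)

lemma N_add_le: "N (x + y) \<le> N x + N y"
  using dist_triangle[of x "- y" 0] dist_N[of x "- y"] dist_N[of x 0] dist_N[of 0 "- y"] by simp

lemma N_diff_le: "N (x - y) \<le> N x + N y"
  using N_add_le[of x "- y"] by simp

lemma N_power: "N (x ^ n) = N x ^ n"
  by (induction n) (auto simp: N_mult)

lemma N_neg_one_power [simp]: "N ((- 1) ^ n) = 1"
  by (simp add: N_power)

lemma N_prod: "N (prod f A) = (\<Prod>x\<in>A. N (f x))"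
  by (induction A rule: infinite_finite_induct) (auto simp: N_mult)

lemma N_sum_le: "N (sum f A) \<le> (\<Sum>x\<in>A. N (f x))"
proof (induction A rule: infinite_finite_induct)
  case (insert x A)
  then show ?case using N_add_le[of "f x" "sum f A"] by simp
qed auto

lemma tendsto_N_iff: "(X \<longlongrightarrow> L) F \<longleftrightarrow> ((\<lambda>n. N (X n - L)) \<longlongrightarrow> 0) F"
  by (subst tendsto_dist_iff) (simp add: dist_N)

lemma tendsto_N_cong:
  assumes "(X \<longlongrightarrow> L) F" "((\<lambda>n. N (Y n - X n)) \<longlongrightarrow> 0) F"
  shows "(Y \<longlongrightarrow> L) F"
  unfolding tendsto_N_iff
proof (rule tendsto_sandwich[where f = "\<lambda>_. 0"])
  show "((\<lambda>n. N (Y n - X n) + N (X n - L)) \<longlongrightarrow> 0) F"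
    using tendsto_add[OF assms(2) assms(1)[unfolded tendsto_N_iff]] by simp
  show "\<forall>\<^sub>F n in F. N (Y n - L) \<le> N (Y n - X n) + N (X n - L)"
    using N_add_le[of "Y n - X n" "X n - L" for n] by simp
qed auto

lemma tendsto_N:
  assumes "(X \<longlongrightarrow> L) F"
  shows "((\<lambda>n. N (X n)) \<longlongrightarrow> N L) F"
  using tendsto_dist[OF assms tendsto_const[of 0]] by (simp add: dist_N)

text \<open>Multiplicativity of \<open>N\<close> makes multiplication continuous, by the splitting
  \<open>X n * Y n - L * M = (X n - L) * Y n + L * (Y n - M)\<close>.\<close>

lemma tendsto_mult_N:
  fixes X Y :: "'b \<Rightarrow> 'a"
  assumes X: "(X \<longlongrightarrow> L) F" and Y: "(Y \<longlongrightarrow> M) F"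
  shows "((\<lambda>n. X n * Y n) \<longlongrightarrow> L * M) F"
  unfolding tendsto_N_iff
proof (rule tendsto_sandwich[where f = "\<lambda>_. 0"])
  show "((\<lambda>n. N (X n - L) * N (Y n) + N L * N (Y n - M)) \<longlongrightarrow> 0) F"
    using tendsto_add[OF tendsto_mult[OF X[unfolded tendsto_N_iff] tendsto_N[OF Y]]
        tendsto_mult[OF tendsto_const[of "N L"] Y[unfolded tendsto_N_iff]]] by simp
  have "N (X n * Y n - L * M) \<le> N (X n - L) * N (Y n) + N L * N (Y n - M)" for n
    using N_add_le[of "(X n - L) * Y n" "L * (Y n - M)"] by (simp add: N_mult[symmetric] algebra_simps)
  then show "\<forall>\<^sub>F n in F. N (X n * Y n - L * M) \<le> N (X n - L) * N (Y n) + N L * N (Y n - M)"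
    by simp
qed auto

section \<open>Convergence by geometric comparison\<close>

lemma convergent_geometric_steps:
  assumes step: "\<And>n. N (X (Suc n) - X n) \<le> D * r ^ n" and r: "0 \<le> r" "r < 1"
  shows "convergent X"
proof -
  have D: "D \<ge> 0"
    using order_trans[OF N_nonneg step[of 0]] by simp
  have diff: "N (X (n + k) - X n) \<le> (\<Sum>i<k. D * r ^ (n + i))" for n k
  proof (induction k)
    case (Suc k)
    then show ?case
      using N_add_le[of "X (Suc (n + k)) - X (n + k)" "X (n + k) - X n"] step[of "n + k"] by simp
  qed simp
  have bound: "N (X (n + k) - X n) \<le> D / (1 - r) * r ^ n" for n k
  proof -
    have "(\<Sum>i<k. D * r ^ (n + i)) = D * r ^ n * (\<Sum>i<k. r ^ i)"
      by (simp add: power_add sum_distrib_left mult_ac)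
    also have "\<dots> \<le> D * r ^ n * (1 / (1 - r))"
      using D r sum_le_suminf[of "\<lambda>i. r ^ i" "{..<k}"]
      by (intro mult_left_mono) (simp_all add: suminf_geometric)
    finally show ?thesis
      using diff[of n k] by (simp add: mult_ac)
  qed
  have "(\<lambda>n. D / (1 - r) * r ^ n) \<longlonglongrightarrow> 0"
    using tendsto_mult[OF tendsto_const LIMSEQ_power_zero[of r]] r by simp
  \<comment> \<open>In this form of the Cauchy property, later terms need only be compared with one
    term \<open>X m\<close>, which is exactly what \<open>bound\<close> controls.\<close>
  then have "Cauchy X"
    unfolding Cauchy_altdef2
  proof (intro allI impI)
    fix e :: real
    assume lim: "(\<lambda>n. D / (1 - r) * r ^ n) \<longlonglongrightarrow> 0" and "e > 0"
    then obtain m where m: "D / (1 - r) * r ^ m < e"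
      using eventually_happens'[OF sequentially_bot order_tendstoD(2)[OF lim \<open>e > 0\<close>]] by blast
    have "dist (X n) (X m) < e" if "n \<ge> m" for n
      using bound[of m "n - m"] m that by (simp add: dist_N)
    then show "\<exists>m. \<forall>n\<ge>m. dist (X n) (X m) < e"
      by blast
  qed
  then show ?thesis
    by (rule Cauchy_convergent)
qed

text \<open>The inverse is the geometric series in \<open>- u\<close>, whose limit exists by
  completeness.\<close>

lemma one_plus_is_unit:
  assumes "N u < 1"
  shows "1 + u dvd 1"
proof -
  define X where "X n = (\<Sum>i<n. (- u) ^ i)" for n
  have "convergent X"
    by (rule convergent_geometric_steps[of X 1 "N u"]) (use assms in \<open>auto simp: X_def N_power\<close>)
  then obtain S where S: "X \<longlonglongrightarrow> S"
    by (auto simp: convergent_def)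
  have X: "(1 + u) * X n - 1 = - ((- u) ^ n)" for n
    by (induction n) (auto simp: X_def algebra_simps)
  have "(\<lambda>n. (1 + u) * X n) \<longlonglongrightarrow> 1"
    unfolding tendsto_N_iff using LIMSEQ_power_zero[of "N u"] assms by (simp add: N_power X)
  moreover have "(\<lambda>n. (1 + u) * X n) \<longlonglongrightarrow> (1 + u) * S"
    by (intro tendsto_mult_N tendsto_const S)
  ultimately have "1 = (1 + u) * S"
    using LIMSEQ_unique by blast
  then show ?thesis ..
qed

text \<open>Follows from \<open>1 + x \<le> exp x\<close>. The bound does not depend on
  \<open>A\<close>, so it serves for initial segments \<open>{..<n}\<close> as well as for the
  blocks \<open>{s..<n}\<close> of the pentagonal identity.\<close>

lemma N_prod_bounded:
  assumes u: "\<And>j. N (u j) \<le> C * r ^ j" and r: "0 \<le> r" "r < 1" and A: "finite A"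
  shows "N (\<Prod>j\<in>A. 1 + u j) \<le> exp (C / (1 - r))"
proof -
  have C: "C \<ge> 0"
    using order_trans[OF N_nonneg u[of 0]] by simp
  have "N (\<Prod>j\<in>A. 1 + u j) \<le> (\<Prod>j\<in>A. 1 + C * r ^ j)"
    unfolding N_prod
  proof (intro prod_mono conjI N_nonneg)
    show "N (1 + u j) \<le> 1 + C * r ^ j" for j
      using N_add_le[of 1 "u j"] u[of j] by simp
  qed
  also have "\<dots> \<le> exp (\<Sum>j\<in>A. C * r ^ j)"
    by (intro prod_le_exp_sum) (use C r in auto)
  also have "(\<Sum>j\<in>A. C * r ^ j) \<le> C / (1 - r)"
    using r C A sum_le_suminf[of "\<lambda>i. r ^ i" A]
    by (simp add: suminf_geometric sum_distrib_left[symmetric] divide_inverse mult_left_mono)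
  finally show ?thesis
    by simp
qed

text \<open>Consecutive partial products differ by the factor \<open>u n\<close> times a uniformly
  bounded partial product.\<close>

lemma convergent_prod_geometric:
  assumes u: "\<And>j. N (u j) \<le> C * r ^ j" and r: "0 \<le> r" "r < 1"
  shows "convergent (\<lambda>n. \<Prod>j<n. 1 + u j)"
proof (rule convergent_geometric_steps)
  fix n
  have "(\<Prod>j<Suc n. 1 + u j) - (\<Prod>j<n. 1 + u j) = (\<Prod>j<n. 1 + u j) * u n"
    by (simp add: algebra_simps)
  then show "N ((\<Prod>j<Suc n. 1 + u j) - (\<Prod>j<n. 1 + u j)) \<le> exp (C / (1 - r)) * C * r ^ n"
    using mult_mono[OF N_prod_bounded[OF u r, of "{..<n}"] u[of n]] by (simp add: N_mult)
qed (use r in auto)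

text \<open>
  The inverses of the factors \<open>1 + u j\<close> are again of the form \<open>1 + v j\<close> with geometrically small
  \<open>v j\<close>, so the product of the inverses converges as well.
\<close>

lemma prod_geometric_unit_limit:
  assumes u: "\<And>j. N (u j) \<le> r ^ Suc j" and r: "0 \<le> r" "r < 1"
  obtains P Q C where "(\<lambda>n. \<Prod>j<n. 1 + u j) \<longlonglongrightarrow> P" "P * Q = 1"
    "\<And>n. (\<Prod>j<n. 1 + u j) dvd 1" "\<And>n. N (1 div (\<Prod>j<n. 1 + u j)) \<le> C"
proof -
  define v where "v j = (1 div (1 + u j)) - 1" for j
  have unit: "1 + u j dvd 1" for j
  proof (rule one_plus_is_unit)
    show "N (u j) < 1"
      using order.strict_trans1[OF u[of j] power_Suc_less_one[of r j]] r
      by (cases "r = 0") (use u[of j] in auto)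
  qed
  have v: "(1 + u j) * (1 + v j) = 1" for j
    using unit_div(1)[OF unit[of j], of 1] by (simp add: v_def)
  have v_le: "N (v j) \<le> 1 / (1 - r) * r ^ j" for j
  proof -
    have "(1 + u j) * v j = - u j"
      using v[of j] by (simp add: algebra_simps add_eq_0_iff)
    then have eq: "N (1 + u j) * N (v j) = N (u j)"
      by (metis N_minus N_mult)
    have rj: "r ^ j \<le> 1" "r ^ Suc j \<le> r ^ j"
      using r power_le_one[of r j] power_decreasing[of j "Suc j" r] by auto
    have "r ^ Suc j \<le> r"
      using r rj(1) mult_left_le[of "r ^ j" r] by simp
    \<comment> \<open>The factors stay away from 0 uniformly in \<open>j\<close>; this is the origin
      of the constant \<open>1 / (1 - r)\<close> in the bound on \<open>v j\<close>.\<close>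
    then have "1 - r \<le> N (1 + u j)"
      using N_diff_le[of "1 + u j" "u j"] u[of j] by simp
    then have "(1 - r) * N (v j) \<le> r ^ j"
      using mult_right_mono[of "1 - r" "N (1 + u j)" "N (v j)"] eq u[of j] rj by simp
    then show ?thesis
      using r by (simp add: field_simps)
  qed
  have u_le: "N (u j) \<le> 1 * r ^ j" for j
    using u[of j] r power_decreasing[of j "Suc j" r] by simp
  obtain P where P: "(\<lambda>n. \<Prod>j<n. 1 + u j) \<longlonglongrightarrow> P"
    using convergent_prod_geometric[OF u_le r] by (auto simp: convergent_def)
  obtain Q where Q: "(\<lambda>n. \<Prod>j<n. 1 + v j) \<longlonglongrightarrow> Q"
    using convergent_prod_geometric[OF v_le r] by (auto simp: convergent_def)
  have prod1: "(\<Prod>j<n. 1 + u j) * (\<Prod>j<n. 1 + v j) = 1" for n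
    by (simp add: prod.distrib[symmetric] v)
  show ?thesis
  proof
    show "P * Q = 1"
      using tendsto_mult_N[OF P Q] by (simp add: prod1 LIMSEQ_const_iff)
    show dvd: "(\<Prod>j<n. 1 + u j) dvd 1" for n
      using prod1[of n] by (metis dvdI)
    have "1 div (\<Prod>j<n. 1 + u j) = (\<Prod>j<n. 1 + v j)" for n
      using unit_div(1)[OF dvd[of n], of 1] prod1[of n] dvd[of n]
      by (metis mult_cancel_left dvd_0_left_iff zero_neq_one)
    then show "N (1 div (\<Prod>j<n. 1 + u j)) \<le> exp (1 / (1 - r) / (1 - r))" for n
      using N_prod_bounded[OF v_le r, of "{..<n}"] by simp
  qed (rule P)
qed

text \<open>With a summable majorant, one exhausting sequence of finite sets determines the
  unordered sum: whatever is added outside \<open>F n\<close> is bounded by the tail of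
  \<open>g\<close>.\<close>

lemma has_sum_of_summable_bound:
  fixes f :: "'b \<Rightarrow> 'a"
  assumes le: "\<And>k. k \<in> A \<Longrightarrow> N (f k) \<le> g k" and g: "g summable_on A"
    and F: "filterlim F (finite_subsets_at_top A) sequentially"
    and L: "(\<lambda>n. sum f (F n)) \<longlonglongrightarrow> L"
  shows "(f has_sum L) A"
  unfolding has_sum_def tendsto_iff
proof (intro allI impI)
  fix e :: real
  assume e: "e > 0"
  obtain G where G: "(g has_sum G) A"
    using g by (auto simp: summable_on_def)
  have "(\<lambda>n. sum g (F n)) \<longlonglongrightarrow> G"
    using filterlim_compose[OF G[unfolded has_sum_def] F] .
  then have "\<forall>\<^sub>F n in sequentially. G - e / 2 < sum g (F n)"
    using e by (intro order_tendstoD(1)) auto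
  moreover have "\<forall>\<^sub>F n in sequentially. dist (sum f (F n)) L < e / 2"
    using tendstoD[OF L, of "e / 2"] e by simp
  moreover have "\<forall>\<^sub>F n in sequentially. finite (F n) \<and> F n \<subseteq> A"
    using F by (auto simp: filterlim_finite_subsets_at_top)
  ultimately have "\<forall>\<^sub>F n in sequentially. G - e / 2 < sum g (F n) \<and>
      dist (sum f (F n)) L < e / 2 \<and> finite (F n) \<and> F n \<subseteq> A"
    by eventually_elim auto
  then obtain n where n: "G - e / 2 < sum g (F n)" "dist (sum f (F n)) L < e / 2"
    "finite (F n)" "F n \<subseteq> A"
    using eventually_happens'[OF sequentially_bot] by blast
  \<comment> \<open>\<open>F n\<close> is the witness: enlarging it to \<open>Y\<close> adds less
    than \<open>G - (G - e / 2) = e / 2\<close> in norm, and \<open>sum f (F n)\<close> is already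
    within \<open>e / 2\<close> of \<open>L\<close>.\<close>
  show "\<forall>\<^sub>F Y in finite_subsets_at_top A. dist (sum f Y) L < e"
    unfolding eventually_finite_subsets_at_top
  proof (intro exI[of _ "F n"] conjI n allI impI)
    fix Y
    assume Y: "finite Y \<and> F n \<subseteq> Y \<and> Y \<subseteq> A"
    have "sum g Y \<le> G"
      using finite_sum_le_has_sum[OF G, of Y] Y order_trans[OF N_nonneg le] by blast
    moreover have "N (sum f (Y - F n)) \<le> sum g (Y - F n)"
      using Y by (intro order_trans[OF N_sum_le] sum_mono le) auto
    moreover have "sum g (Y - F n) = sum g Y - sum g (F n)"
      using Y by (auto simp: sum_diff)
    moreover have "sum f Y - L = sum f (Y - F n) + (sum f (F n) - L)"
      using Y by (auto simp: sum_diff)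
    then have "N (sum f Y - L) \<le> N (sum f (Y - F n)) + N (sum f (F n) - L)"
      by (simp only: N_add_le)
    ultimately show "dist (sum f Y) L < e"
      using n(1,2) unfolding dist_N by linarith
  qed
qed

end

section \<open>The finite pentagonal identity\<close>

lemma sum_int_Suc_symmetric:
  fixes f :: "int \<Rightarrow> 'a::comm_monoid_add"
  shows "(\<Sum>k\<in>{- int (Suc n)..int (Suc n)}. f k) =
    (\<Sum>k\<in>{- int n..int n}. f k) + f (int (Suc n)) + f (- int (Suc n))"
proof -
  have "{- int (Suc n)..int (Suc n)} =
      insert (- int (Suc n)) (insert (int (Suc n)) {- int n..int n})"
    by auto
  then show ?thesis
    by (simp add: add_ac)
qed

text \<open>
  Shanks' finite form of the pentagonal number theorem. Its summand for \<open>s = 0\<close> is the partial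
  product, and all others are divisible by \<open>q ^ (2 * n)\<close>.
\<close>

lemma finite_pentagonal:
  fixes q :: "'a::comm_ring_1"
  shows "(\<Sum>s\<le>n. (-1) ^ s * (\<Prod>j\<in>{s..<n}. 1 - q ^ (2 * Suc j)) * q ^ (2 * s * n + s\<^sup>2 + s)) =
    (\<Sum>k\<in>{- int n..int n}. (-1) ^ nat \<bar>k\<bar> * q ^ nat (3 * k\<^sup>2 - k))"
proof (induction n)
  case (Suc n)
  define D where "D s = (\<Prod>j\<in>{s..<n}. 1 - q ^ (2 * Suc j))" for s
  define T where "T m s = (-1) ^ s * (\<Prod>j\<in>{s..<m}. 1 - q ^ (2 * Suc j)) * q ^ (2 * s * m + s\<^sup>2 + s)"
    for m s
  \<comment> \<open>\<open>V\<close> is a telescoping certificate for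
    \<open>T (Suc n) s - T n s\<close>. For \<open>s \<le> n\<close> it equals
    \<open>- (1 - q ^ (2 * s)) * T n s\<close>. Writing it with \<open>k = s - 1\<close> absorbs the
    factor \<open>1 - q ^ (2 * s)\<close> into \<open>D k\<close> and gives the correct boundary
    value at \<open>s = Suc n\<close>, where \<open>D n\<close> is the empty product.\<close>
  define V where "V s = (case s of 0 \<Rightarrow> 0 | Suc k \<Rightarrow>
    (-1) ^ k * D k * q ^ (2 * Suc k * Suc n + k\<^sup>2 + k))" for s
  have step: "T (Suc n) s - T n s = V s - V (Suc s)" if "s \<le> n" for s
  proof -
    define a b c where "a = q ^ (2 * s * n + s\<^sup>2 + s)" and "b = q ^ (2 * s)" and "c = q ^ (2 * Suc n)"
    have "2 * s * Suc n + s\<^sup>2 + s = (2 * s * n + s\<^sup>2 + s) + 2 * s"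
      "2 * Suc s * Suc n + s\<^sup>2 + s = (2 * s * n + s\<^sup>2 + s) + 2 * s + 2 * Suc n"
      by auto
    then have ab: "q ^ (2 * s * Suc n + s\<^sup>2 + s) = a * b"
      and abc: "q ^ (2 * Suc s * Suc n + s\<^sup>2 + s) = a * b * c"
      unfolding a_def b_def c_def by (simp_all only: power_add)
    have T: "T (Suc n) s = (-1) ^ s * (D s * (1 - c)) * (a * b)" "T n s = (-1) ^ s * D s * a"
      using that ab by (simp_all add: T_def D_def a_def c_def)
    have V_Suc: "V (Suc s) = (-1) ^ s * D s * (a * b * c)"
      using abc by (simp add: V_def)
    have V: "V s = - ((-1) ^ s * D s * (a * (1 - b)))"
    proof (cases s)
      case 0
      then show ?thesis by (simp add: V_def b_def)
    next
      case (Suc k)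
      have "2 * Suc k * Suc n + k\<^sup>2 + k = 2 * s * n + s\<^sup>2 + s"
        by (simp add: Suc power2_eq_square)
      then have "V s = (-1) ^ k * D k * a"
        by (simp only: V_def a_def Suc nat.case)
      moreover have "D k = (1 - b) * D s"
        using that Suc by (simp add: D_def b_def prod.atLeast_Suc_lessThan)
      ultimately show ?thesis
        by (simp add: Suc algebra_simps)
    qed
    show ?thesis
      unfolding T V_Suc V by (simp add: algebra_simps)
  qed
  have "(\<Sum>s\<le>n. T (Suc n) s) - (\<Sum>s\<le>n. T n s) = (\<Sum>s\<le>n. V s - V (Suc s))"
    by (simp add: step sum_subtractf[symmetric])
  also have "\<dots> = - V (Suc n)"
    by (subst sum_telescope) (simp add: V_def)
  also have "\<dots> = (-1) ^ Suc n * q ^ (2 * Suc n * Suc n + n\<^sup>2 + n)"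
    by (simp add: V_def D_def)
  \<comment> \<open>The boundary term of the telescoping is the new theta term for
    \<open>k = n + 1\<close>; the new summand \<open>s = n + 1\<close> below supplies the one for
    \<open>k = - (n + 1)\<close>.\<close>
  also have "2 * Suc n * Suc n + n\<^sup>2 + n = nat (3 * (int (Suc n))\<^sup>2 - int (Suc n))"
    by (simp add: nat_eq_iff2 power2_eq_square algebra_simps)
  finally have lower: "(\<Sum>s\<le>n. T (Suc n) s) =
      (\<Sum>s\<le>n. T n s) + (-1) ^ Suc n * q ^ nat (3 * (int (Suc n))\<^sup>2 - int (Suc n))"
    by (simp add: algebra_simps)
  have "2 * Suc n * Suc n + (Suc n)\<^sup>2 + Suc n = nat (3 * (- int (Suc n))\<^sup>2 - (- int (Suc n)))"
    by (simp add: nat_eq_iff2 power2_eq_square algebra_simps)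
  then have top: "T (Suc n) (Suc n) = (-1) ^ Suc n * q ^ nat (3 * (- int (Suc n))\<^sup>2 - (- int (Suc n)))"
    by (simp add: T_def)
  have "(\<Sum>s\<le>Suc n. T (Suc n) s) = (\<Sum>s\<le>n. T n s) +
      (-1) ^ Suc n * q ^ nat (3 * (int (Suc n))\<^sup>2 - int (Suc n)) +
      (-1) ^ Suc n * q ^ nat (3 * (- int (Suc n))\<^sup>2 - (- int (Suc n)))"
    unfolding sum.atMost_Suc lower top ..
  also have "(\<Sum>s\<le>n. T n s) = (\<Sum>k\<in>{- int n..int n}. (-1) ^ nat \<bar>k\<bar> * q ^ nat (3 * k\<^sup>2 - k))"
    using Suc.IH by (simp only: T_def)
  finally show ?case
    unfolding sum_int_Suc_symmetric T_def by (simp only: abs_minus abs_of_nat nat_int)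
qed simp

section \<open>Finite identities for Euler's series\<close>

context
  fixes q :: "'a::comm_ring_1" and b :: "nat \<Rightarrow> 'a"
  assumes b_0: "b 0 = 1"
    and b_Suc: "\<And>m. (1 - q ^ Suc m) * b (Suc m) = q ^ Suc m * b m"
begin

text \<open>By \<open>b_Suc\<close>, the difference of the sums for \<open>k\<close> and
  \<open>Suc k\<close> has terms \<open>q ^ (k * m) * (1 - q ^ m) * b m = q ^ (k * m + m) * b (m -
  1)\<close> for \<open>m > 0\<close>. Reindexing gives \<open>q ^ Suc k\<close> times the sum for
  \<open>Suc k\<close>, short of its last term; that term is the correction.\<close>

lemma euler_sum_shift:
  "(\<Sum>m\<le>M. q ^ (k * m) * b m) =
    (1 + q ^ Suc k) * (\<Sum>m\<le>M. q ^ (Suc k * m) * b m) - q ^ (Suc k * Suc M) * b M"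
proof (induction M)
  case 0
  then show ?case by (simp add: b_0)
next
  case (Suc M)
  define x y z where "x = q ^ (k * Suc M)" and "y = q ^ Suc M" and "z = q ^ Suc k"
  have p: "q ^ (Suc k * Suc M) = x * y" "q ^ (Suc k * Suc (Suc M)) = x * y * z"
    by (simp_all add: x_def y_def z_def power_add[symmetric] algebra_simps)
  have b: "x * b (Suc M) = x * (y * b M) + x * (y * b (Suc M))"
    using b_Suc[of M] unfolding y_def[symmetric] by (simp add: algebra_simps flip: distrib_left)
  show ?case
    unfolding sum.atMost_Suc Suc.IH p z_def[symmetric] x_def[symmetric]
    by (simp add: algebra_simps b)
qed

text \<open>\<open>K\<close> applications of the shift, with each truncation error weighted by the
  product accumulated so far.\<close>

lemma euler_sum_iterate:
  "(\<Sum>m\<le>M. b m) = (\<Prod>j<K. 1 + q ^ Suc j) * (\<Sum>m\<le>M. q ^ (K * m) * b m) -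
    (\<Sum>k<K. (\<Prod>j<k. 1 + q ^ Suc j) * (q ^ (Suc k * Suc M) * b M))"
proof (induction K)
  case (Suc K)
  have "(\<Prod>j<K. 1 + q ^ Suc j) * (\<Sum>m\<le>M. q ^ (K * m) * b m) =
      (\<Prod>j<Suc K. 1 + q ^ Suc j) * (\<Sum>m\<le>M. q ^ (Suc K * m) * b m) -
      (\<Prod>j<K. 1 + q ^ Suc j) * (q ^ (Suc K * Suc M) * b M)"
    unfolding euler_sum_shift[of K] prod.lessThan_Suc by (simp only: algebra_simps)
  then show ?case
    using Suc.IH unfolding sum.lessThan_Suc by (simp only: diff_diff_eq add.commute)
qed simp

end

section \<open>Infinite products and sums over the integers\<close>

lemma has_prod_of_tendsto:
  assumes "(\<lambda>n. \<Prod>j<n. f j) \<longlonglongrightarrow> P" "P \<noteq> 0"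
  shows "f has_prod P"
  using assms by (simp add: has_prod_def raw_has_prod_def LIMSEQ_lessThan_iff_atMost)

lemma filterlim_int_symmetric_finite_subsets:
  "filterlim (\<lambda>n. {- int n..int n}) (finite_subsets_at_top UNIV) sequentially"
  unfolding filterlim_finite_subsets_at_top
proof (intro allI impI)
  fix X :: "int set"
  assume X: "finite X \<and> X \<subseteq> UNIV"
  define m where "m = Max (insert 0 ((\<lambda>k. nat \<bar>k\<bar>) ` X))"
  have "nat \<bar>k\<bar> \<le> m" if "k \<in> X" for k
    unfolding m_def using X that by (intro Max_ge) auto
  then have "X \<subseteq> {- int n..int n}" if "n \<ge> m" for n
    using that by fastforce
  then show "\<forall>\<^sub>F n in sequentially. finite {- int n..int n} \<and> X \<subseteq> {- int n..int n} \<and>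
      {- int n..int n} \<subseteq> UNIV"
    unfolding eventually_sequentially by auto
qed

lemma summable_on_power_nat_abs:
  fixes r :: real
  assumes "0 \<le> r" "r < 1"
  shows "(\<lambda>k::int. r ^ nat \<bar>k\<bar>) summable_on UNIV"
proof -
  have geo: "(\<lambda>n. r ^ n) summable_on UNIV"
    using assms by (simp add: summable_on_UNIV_nonneg_real_iff)
  have "(\<lambda>k::int. r ^ nat \<bar>k\<bar>) summable_on range int"
    using geo by (subst summable_on_reindex) (auto simp: o_def)
  moreover have "(\<lambda>k::int. r ^ nat \<bar>k\<bar>) summable_on range (\<lambda>n. - int n)"
    using geo by (subst summable_on_reindex) (auto simp: o_def inj_on_def)
  moreover have "UNIV = range int \<union> range (\<lambda>n. - int n)"
    using int_cases2 by blast
  ultimately show ?thesis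
    using summable_on_union by metis
qed

text \<open>Gives the majorant \<open>r ^ nat \<bar>k\<bar>\<close> for the theta series; it also
  shows that \<open>nat\<close> truncates none of the exponents.\<close>

lemma abs_le_pentagonal: "\<bar>k\<bar> \<le> 3 * k\<^sup>2 - k" for k :: int
proof -
  have "\<bar>k\<bar> \<le> k\<^sup>2"
    by (metis abs_ge_zero abs_le_square_iff abs_mult_self_eq abs_of_nonneg int_one_le_iff_zero_less
        le_less linorder_not_le mult_le_cancel_right1 power2_eq_square zero_less_abs_iff)
  then show ?thesis
    by linarith
qed

section \<open>Limits of the theta series and of Euler's series\<close>

context multiplicative_norm
begin

text \<open>In the finite identity the summand \<open>s = 0\<close> is the partial product, and each
  of the other \<open>n\<close> summands has norm at most \<open>C * r ^ n\<close>; their total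
  vanishes because \<open>n * r ^ n\<close> tends to 0.\<close>

lemma pentagonal_tendsto:
  assumes q: "N q < 1"
    and P: "(\<lambda>n. \<Prod>j<n. 1 - (q\<^sup>2) ^ j * q\<^sup>2) \<longlonglongrightarrow> P"
  shows "(\<lambda>n. \<Sum>k\<in>{- int n..int n}. (-1) ^ nat \<bar>k\<bar> * q ^ nat (3 * k\<^sup>2 - k)) \<longlonglongrightarrow> P"
  unfolding finite_pentagonal[symmetric]
proof (rule tendsto_N_cong[OF P], rule tendsto_sandwich[where f = "\<lambda>_. 0"])
  define r where "r = N q"
  have r: "0 \<le> r" "r < 1"
    using q by (auto simp: r_def)
  define C where "C = exp (1 / (1 - r))"
  define T where "T n s = (-1) ^ s * (\<Prod>j\<in>{s..<n}. 1 - q ^ (2 * Suc j)) * q ^ (2 * s * n + s\<^sup>2 + s)"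
    for n s
  have D: "N (\<Prod>j\<in>{s..<n}. 1 - q ^ (2 * Suc j)) \<le> C" for s n
    using N_prod_bounded[of "\<lambda>j. - (q ^ (2 * Suc j))" 1 r "{s..<n}"] r
      power_decreasing[of j "2 * Suc j" r for j]
    by (simp add: N_power C_def r_def del: power_Suc)
  have T: "N (T n s) \<le> C * r ^ n" if "s \<in> {1..n}" for n s
  proof -
    have "n \<le> 2 * s * n + s\<^sup>2 + s"
      using that by (cases s) auto
    then have "r ^ (2 * s * n + s\<^sup>2 + s) \<le> r ^ n"
      using r by (intro power_decreasing) auto
    then show ?thesis
      using mult_mono[OF D[of s n], of "r ^ (2 * s * n + s\<^sup>2 + s)" "r ^ n"] r
      by (simp add: T_def N_mult N_power r_def[symmetric] C_def)
  qed
  have "N ((\<Sum>s\<le>n. T n s) - (\<Prod>j<n. 1 - (q\<^sup>2) ^ j * q\<^sup>2)) \<le> C * (real n * r ^ n)" for n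
  proof -
    have "(\<Prod>j<n. 1 - (q\<^sup>2) ^ j * q\<^sup>2) = T n 0"
      by (simp add: T_def atLeast0LessThan power_mult[symmetric] power_add[symmetric] add.commute)
    moreover have "{..n} = insert 0 {1..n}"
      by auto
    ultimately have "(\<Sum>s\<le>n. T n s) - (\<Prod>j<n. 1 - (q\<^sup>2) ^ j * q\<^sup>2) = (\<Sum>s\<in>{1..n}. T n s)"
      by simp
    moreover have "(\<Sum>s\<in>{1..n}. N (T n s)) \<le> (\<Sum>s\<in>{1..n}. C * r ^ n)"
      by (intro sum_mono T)
    ultimately show ?thesis
      using N_sum_le[of "T n" "{1..n}"] by (simp add: mult_ac)
  qed
  then show "\<forall>\<^sub>F n in sequentially. N ((\<Sum>s\<le>n. (-1) ^ s * (\<Prod>j\<in>{s..<n}. 1 - q ^ (2 * Suc j)) *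
      q ^ (2 * s * n + s\<^sup>2 + s)) - (\<Prod>j<n. 1 - (q\<^sup>2) ^ j * q\<^sup>2)) \<le> C * (real n * r ^ n)"
    unfolding T_def by simp
  show "(\<lambda>n. C * (real n * r ^ n)) \<longlonglongrightarrow> 0"
    using tendsto_mult_right_zero[OF powser_times_n_limit_0[of r]] r by simp
qed auto

lemma euler_sum_tendsto:
  assumes q: "N q < 1"
    and b_0: "b 0 = 1" and b_Suc: "\<And>m. (1 - q ^ Suc m) * b (Suc m) = q ^ Suc m * b m"
    and b_le: "\<And>m. N (b m) \<le> C"
    and P: "(\<lambda>n. \<Prod>j<n. 1 + q ^ Suc j) \<longlonglongrightarrow> P"
  shows "(\<lambda>n. \<Sum>m<n. b m) \<longlonglongrightarrow> P"
proof -
  define r where "r = N q"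
  have r: "0 \<le> r" "r < 1"
    using q by (auto simp: r_def)
  define B where "B = exp (1 / (1 - r))"
  have C: "C \<ge> 0"
    using order_trans[OF N_nonneg b_le[of 0]] .
  define R where "R k = (\<Prod>j<k. 1 + q ^ Suc j)" for k
  have R: "N (R k) \<le> B" for k
    using N_prod_bounded[of "\<lambda>j. q ^ Suc j" 1 r "{..<k}"] r power_decreasing[of j "Suc j" r for j]
    by (simp add: N_power B_def r_def R_def del: power_Suc)
  \<comment> \<open>The shift is iterated \<open>K = M\<close> times, so that one parameter controls
    both errors: the distance of the weighted sum from its term 1 at \<open>m = 0\<close>, and the
    \<open>M\<close> truncation errors. Each contributes at most
    \<open>B * C * (real M * r ^ M)\<close>.\<close>
  have bound: "N ((\<Sum>m\<le>M. b m) - R M) \<le> 2 * B * C * (real M * r ^ M)" for M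
  proof -
    have t1: "N (q ^ (M * m) * b m) \<le> C * r ^ M" if "m \<in> {1..M}" for m
    proof -
      have "M * 1 \<le> M * m"
        using that by (intro mult_left_mono) auto
      then have "r ^ (M * m) \<le> r ^ M"
        using r by (intro power_decreasing) auto
      then show ?thesis
        using mult_mono[OF _ b_le[of m], of "r ^ (M * m)" "r ^ M"] r
        by (simp add: N_mult N_power r_def[symmetric] mult.commute)
    qed
    have "{..M} = insert 0 {1..M}"
      by auto
    then have "(\<Sum>m\<le>M. q ^ (M * m) * b m) - 1 = (\<Sum>m\<in>{1..M}. q ^ (M * m) * b m)"
      by (simp add: b_0)
    moreover have "(\<Sum>m\<in>{1..M}. N (q ^ (M * m) * b m)) \<le> (\<Sum>m\<in>{1..M}. C * r ^ M)"
      by (intro sum_mono t1)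
    ultimately have s1: "N ((\<Sum>m\<le>M. q ^ (M * m) * b m) - 1) \<le> C * (real M * r ^ M)"
      using N_sum_le[of "\<lambda>m. q ^ (M * m) * b m" "{1..M}"] by (simp add: mult_ac)
    have t2: "N (R k * (q ^ (Suc k * Suc M) * b M)) \<le> B * C * r ^ M" for k
    proof -
      have "r ^ (Suc k * Suc M) \<le> r ^ M"
        using r by (intro power_decreasing) auto
      then have "r ^ (Suc k * Suc M) * N (b M) \<le> r ^ M * C"
        using r b_le by (intro mult_mono) auto
      then have "N (R k) * (r ^ (Suc k * Suc M) * N (b M)) \<le> B * (r ^ M * C)"
        by (rule mult_mono[OF R]) (use r in \<open>auto simp: B_def\<close>)
      then show ?thesis
        by (simp only: N_mult N_power r_def[symmetric] mult_ac)
    qed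
    have "(\<Sum>k<M. N (R k * (q ^ (Suc k * Suc M) * b M))) \<le> (\<Sum>k<M. B * C * r ^ M)"
      by (intro sum_mono t2)
    then have s2: "N (\<Sum>k<M. R k * (q ^ (Suc k * Suc M) * b M)) \<le> B * C * (real M * r ^ M)"
      using N_sum_le[of "\<lambda>k. R k * (q ^ (Suc k * Suc M) * b M)" "{..<M}"] by (simp add: mult_ac)
    have "N (R M * ((\<Sum>m\<le>M. q ^ (M * m) * b m) - 1)) \<le> B * (C * (real M * r ^ M))"
      unfolding N_mult using R s1 by (intro mult_mono) (auto simp: B_def)
    moreover have "(\<Sum>m\<le>M. b m) - R M = R M * ((\<Sum>m\<le>M. q ^ (M * m) * b m) - 1) -
        (\<Sum>k<M. R k * (q ^ (Suc k * Suc M) * b M))"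
      unfolding euler_sum_iterate[of b q M M, OF b_0 b_Suc] R_def by (simp add: algebra_simps)
    ultimately show ?thesis
      using s2 N_diff_le[of "R M * ((\<Sum>m\<le>M. q ^ (M * m) * b m) - 1)"
          "\<Sum>k<M. R k * (q ^ (Suc k * Suc M) * b M)"] by (simp add: mult_ac)
  qed
  have "(\<lambda>M. N ((\<Sum>m\<le>M. b m) - R M)) \<longlonglongrightarrow> 0"
  proof (rule tendsto_sandwich[where f = "\<lambda>_. 0"])
    show "(\<lambda>M. 2 * B * C * (real M * r ^ M)) \<longlonglongrightarrow> 0"
      using tendsto_mult_right_zero[OF powser_times_n_limit_0[of r]] r by simp
  qed (use bound in auto)
  then have "(\<lambda>M. \<Sum>m\<le>M. b m) \<longlonglongrightarrow> P"
    unfolding R_def by (rule tendsto_N_cong[OF P])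
  then show ?thesis
    by (simp add: LIMSEQ_lessThan_iff_atMost)
qed

section \<open>The identity for a general multiplicative norm\<close>

lemma qpoch_identity:
  assumes q: "N q < 1"
  shows "summable (\<lambda>n. q ^ (2 * n^2 + n) div qpoch q q (2 * n + 1)) \<and>
      (\<lambda>k::int. (-1) ^ nat \<bar>k\<bar> * q ^ nat (3 * k^2 - k)) summable_on UNIV \<and>
      convergent_prod (\<lambda>j. 1 - q ^ j * q) \<and>
      convergent_prod (\<lambda>j. 1 - (q^2) ^ j * q^2) \<and>
      convergent_prod (\<lambda>j. 1 - q ^ j * (- q)) \<and>
      (\<Sum>n. q ^ (2 * n^2 + n) div qpoch q q (2 * n + 1)) =
        1 div qpoch_inf q q *
          (\<Sum>\<^sub>\<infinity>k\<in>(UNIV :: int set). (-1) ^ nat \<bar>k\<bar> * q ^ nat (3 * k^2 - k)) \<and>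
      1 div qpoch_inf q q *
          (\<Sum>\<^sub>\<infinity>k\<in>(UNIV :: int set). (-1) ^ nat \<bar>k\<bar> * q ^ nat (3 * k^2 - k)) =
        qpoch_inf (q^2) (q^2) div qpoch_inf q q \<and>
      qpoch_inf (q^2) (q^2) div qpoch_inf q q = qpoch_inf (- q) q"
proof -
  define r where "r = N q"
  have r: "0 \<le> r" "r < 1"
    using q by (auto simp: r_def)
  \<comment> \<open>The cofactor \<open>Q\<close> makes the limit a unit, hence nonzero as
    \<open>convergent_prod\<close> demands and usable as a divisor. The bound \<open>C\<close> on
    the inverses later bounds \<open>b\<close>.\<close>
  obtain P Q C where P: "(\<lambda>n. \<Prod>j<n. 1 + - (q ^ j * q)) \<longlonglongrightarrow> P" "P * Q = 1"
    and unit: "\<And>n. (\<Prod>j<n. 1 + - (q ^ j * q)) dvd 1"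
    and C: "\<And>n. N (1 div (\<Prod>j<n. 1 + - (q ^ j * q))) \<le> C"
    by (rule prod_geometric_unit_limit[of "\<lambda>j. - (q ^ j * q)" r])
      (use r in \<open>auto simp: N_mult N_power r_def mult.commute\<close>)
  have r2: "(r\<^sup>2) ^ j * r\<^sup>2 \<le> r ^ Suc j" for j
    using r power_decreasing[of "Suc j" "2 * Suc j" r]
    by (simp add: power_mult power_mult_distrib power2_eq_square mult_ac)
  obtain P2 Q2 where P2: "(\<lambda>n. \<Prod>j<n. 1 + - ((q\<^sup>2) ^ j * q\<^sup>2)) \<longlonglongrightarrow> P2" "P2 * Q2 = 1"
    by (rule prod_geometric_unit_limit[of "\<lambda>j. - ((q\<^sup>2) ^ j * q\<^sup>2)" r])
      (use r r2 in \<open>auto simp: N_mult N_power r_def\<close>)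
  obtain P3 Q3 where P3: "(\<lambda>n. \<Prod>j<n. 1 + q ^ Suc j) \<longlonglongrightarrow> P3" "P3 * Q3 = 1"
    by (rule prod_geometric_unit_limit[of "\<lambda>j. q ^ Suc j" r])
      (use r in \<open>auto simp: N_mult N_power r_def\<close>)
  have prod1: "(\<lambda>j. 1 - q ^ j * q) has_prod P"
    using P by (intro has_prod_of_tendsto) auto
  have prod2: "(\<lambda>j. 1 - (q\<^sup>2) ^ j * q\<^sup>2) has_prod P2"
    using P2 by (intro has_prod_of_tendsto) auto
  have prod3: "(\<lambda>j. 1 - q ^ j * (- q)) has_prod P3"
    using P3 by (intro has_prod_of_tendsto) (auto simp: mult.commute)
  have inf: "qpoch_inf q q = P" "qpoch_inf (q\<^sup>2) (q\<^sup>2) = P2" "qpoch_inf (- q) q = P3"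
    using prod1 prod2 prod3 by (simp_all add: qpoch_inf_def has_prod_unique[symmetric])
  have conv: "convergent_prod (\<lambda>j. 1 - q ^ j * q)" "convergent_prod (\<lambda>j. 1 - (q\<^sup>2) ^ j * q\<^sup>2)"
    "convergent_prod (\<lambda>j. 1 - q ^ j * (- q))"
    using prod1 prod2 prod3 P(2) P2(2) P3(2) unfolding has_prod_def convergent_prod_def by auto

  \<comment> \<open>Factorwise difference of squares, which yields the last equality of the
    chain.\<close>
  have "(1 + - (q ^ j * q)) * (1 + q ^ Suc j) = 1 + - ((q\<^sup>2) ^ j * q\<^sup>2)" for j
    by (simp add: algebra_simps power2_eq_square power_mult_distrib)
  then have "(\<lambda>n. \<Prod>j<n. 1 + - ((q\<^sup>2) ^ j * q\<^sup>2)) \<longlonglongrightarrow> P * P3"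
    using tendsto_mult_N[OF P(1) P3(1)] by (simp only: prod.distrib[symmetric])
  then have P2_eq: "P2 = P * P3"
    using P2(1) LIMSEQ_unique by blast
  have P_unit: "P dvd 1" "P \<noteq> 0"
    using P(2) by (auto intro: dvdI[of _ _ Q])

  define f where "f = (\<lambda>k::int. (-1) ^ nat \<bar>k\<bar> * q ^ nat (3 * k\<^sup>2 - k))"
  have "(f has_sum P2) UNIV"
  proof (rule has_sum_of_summable_bound)
    show "N (f k) \<le> r ^ nat \<bar>k\<bar>" for k
      using r abs_le_pentagonal[of k]
      by (auto simp: f_def N_mult N_power r_def[symmetric] intro!: power_decreasing nat_mono)
    show "(\<lambda>n. sum f {- int n..int n}) \<longlonglongrightarrow> P2"
      unfolding f_def using P2(1) by (intro pentagonal_tendsto q) simp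
  qed (use summable_on_power_nat_abs filterlim_int_symmetric_finite_subsets r in auto)
  then have pent: "f summable_on UNIV" "infsum f UNIV = P2"
    by (auto simp: summable_on_def infsumI)

  \<comment> \<open>The product over \<open>j\<close> encodes \<open>q ^ (m * (m + 1) div 2)\<close>
    without a halved exponent.\<close>
  define b where "b m = (\<Prod>j<m. q ^ Suc j) * (1 div qpoch q q m)" for m
  have qpoch_unit: "qpoch q q m dvd 1" for m
    using unit[of m] by (simp add: qpoch_def)
  have inv_Suc: "(1 - q ^ Suc m) * (1 div qpoch q q (Suc m)) = 1 div qpoch q q m" for m
  proof -
    have nz: "qpoch q q m \<noteq> 0"
      using qpoch_unit[of m] by auto
    have "qpoch q q m * ((1 - q ^ Suc m) * (1 div qpoch q q (Suc m))) =
        qpoch q q (Suc m) * (1 div qpoch q q (Suc m))"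
      by (simp add: qpoch_def mult_ac)
    also have "\<dots> = qpoch q q m * (1 div qpoch q q m)"
      using unit_div(1)[OF qpoch_unit] by simp
    finally show ?thesis
      using nz by simp
  qed
  have b_0: "b 0 = 1"
    by (simp add: b_def qpoch_def)
  have b_Suc: "(1 - q ^ Suc m) * b (Suc m) = q ^ Suc m * b m" for m
    unfolding b_def prod.lessThan_Suc inv_Suc[of m, symmetric] by (simp only: mult_ac)
  have b_le: "N (b m) \<le> C" for m
  proof -
    have "N (\<Prod>j<m. q ^ Suc j) \<le> 1"
      unfolding N_prod N_power r_def[symmetric]
      using r by (intro prod_le_1) (auto simp: mult_le_one power_le_one)
    then have "N (b m) \<le> 1 * N (1 div qpoch q q m)"
      unfolding b_def N_mult by (intro mult_right_mono) auto
    then show ?thesis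
      using C[of m] by (simp add: qpoch_def)
  qed
  have b_lim: "(\<lambda>n. \<Sum>m<n. b m) \<longlonglongrightarrow> P3"
    by (rule euler_sum_tendsto[OF q b_0 b_Suc b_le P3(1)])
  have q_prod: "(\<Prod>j<2 * n. q ^ Suc j) = q ^ (2 * n\<^sup>2 + n)" for n
    by (induction n) (simp_all add: power_add[symmetric] power2_eq_square algebra_simps)
  have summand: "q ^ (2 * n\<^sup>2 + n) div qpoch q q (2 * n + 1) = b (2 * n) + b (2 * n + 1)" for n
  proof -
    \<comment> \<open>Over the common denominator \<open>qpoch q q (2 * n + 1)\<close>, the
      numerators carry the factors \<open>1 - q ^ (2 * n + 1)\<close> and
      \<open>q ^ (2 * n + 1)\<close>, which add up to 1.\<close>
    have "b (2 * n) = q ^ (2 * n\<^sup>2 + n) * ((1 - q ^ Suc (2 * n)) * (1 div qpoch q q (Suc (2 * n))))"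
      unfolding b_def q_prod inv_Suc ..
    moreover have "b (2 * n + 1) =
        q ^ (2 * n\<^sup>2 + n) * q ^ Suc (2 * n) * (1 div qpoch q q (Suc (2 * n)))"
      unfolding b_def Suc_eq_plus1[symmetric] prod.lessThan_Suc q_prod ..
    ultimately have "b (2 * n) + b (2 * n + 1) =
        q ^ (2 * n\<^sup>2 + n) * (1 div qpoch q q (Suc (2 * n)))"
      by (simp add: algebra_simps)
    also have "\<dots> = q ^ (2 * n\<^sup>2 + n) div qpoch q q (2 * n + 1)"
      using qpoch_unit[of "Suc (2 * n)"] by (simp add: unit_div(2))
    finally show ?thesis ..
  qed
  \<comment> \<open>Pairing produces the even-indexed partial sums of \<open>b\<close>, a
    subsequence of a convergent sequence.\<close>
  have "(\<Sum>n<k. b (2 * n) + b (2 * n + 1)) = (\<Sum>m<2 * k. b m)" for k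
    by (induction k) simp_all
  moreover have "filterlim (\<lambda>k. 2 * k :: nat) at_top sequentially"
    by (rule filterlim_subseq) (auto simp: strict_mono_def)
  then have "(\<lambda>k. \<Sum>m<2 * k. b m) \<longlonglongrightarrow> P3"
    using b_lim filterlim_compose by blast
  ultimately have sums: "(\<lambda>n. q ^ (2 * n\<^sup>2 + n) div qpoch q q (2 * n + 1)) sums P3"
    unfolding sums_def summand by simp

  have "1 div P * P2 = P2 div P"
    using unit_div(2)[OF P_unit(1), of P2] by (simp add: mult.commute)
  moreover have "P2 div P = P3"
    using P_unit by (simp add: P2_eq)
  ultimately show ?thesis
    using sums conv pent unfolding inf f_def by (simp add: sums_iff)
qed

end

section \<open>Complex numbers and formal power series\<close>

lemma multiplicative_norm_complex: "multiplicative_norm (norm :: complex \<Rightarrow> real)"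
  by unfold_locales (simp_all add: dist_norm norm_mult)

text \<open>Over a field, subdegrees of nonzero series add under multiplication, so
  \<open>2 ^ (- subdegree f)\<close> is multiplicative.\<close>

lemma multiplicative_norm_fps: "multiplicative_norm (\<lambda>f :: 'a::field fps. dist f 0)"
  by unfold_locales (simp_all add: dist_fps_def power_add)

theorem corollary5p6:
  shows "(let q = (fps_X :: 'a::field_char_0 fps) in
      summable (\<lambda>n. q ^ (2 * n^2 + n) / qpoch q q (2 * n + 1)) \<and>
      (\<lambda>k::int. (-1) ^ nat \<bar>k\<bar> * q ^ nat (3 * k^2 - k)) summable_on UNIV \<and>
      convergent_prod (\<lambda>j. 1 - q ^ j * q) \<and>
      convergent_prod (\<lambda>j. 1 - (q^2) ^ j * q^2) \<and>
      convergent_prod (\<lambda>j. 1 - q ^ j * (- q)) \<and>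
      (\<Sum>n. q ^ (2 * n^2 + n) / qpoch q q (2 * n + 1)) =
        1 / qpoch_inf q q *
          (\<Sum>\<^sub>\<infinity>k\<in>(UNIV :: int set). (-1) ^ nat \<bar>k\<bar> * q ^ nat (3 * k^2 - k)) \<and>
      1 / qpoch_inf q q *
          (\<Sum>\<^sub>\<infinity>k\<in>(UNIV :: int set). (-1) ^ nat \<bar>k\<bar> * q ^ nat (3 * k^2 - k)) =
        qpoch_inf (q^2) (q^2) / qpoch_inf q q \<and>
      qpoch_inf (q^2) (q^2) / qpoch_inf q q = qpoch_inf (- q) q) \<and>
    (\<forall>q::complex. norm q < 1 \<longrightarrow>
      summable (\<lambda>n. q ^ (2 * n^2 + n) / qpoch q q (2 * n + 1)) \<and>
      (\<lambda>k::int. (-1) ^ nat \<bar>k\<bar> * q ^ nat (3 * k^2 - k)) summable_on UNIV \<and>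
      convergent_prod (\<lambda>j. 1 - q ^ j * q) \<and>
      convergent_prod (\<lambda>j. 1 - (q^2) ^ j * q^2) \<and>
      convergent_prod (\<lambda>j. 1 - q ^ j * (- q)) \<and>
      (\<Sum>n. q ^ (2 * n^2 + n) / qpoch q q (2 * n + 1)) =
        1 / qpoch_inf q q *
          (\<Sum>\<^sub>\<infinity>k\<in>(UNIV :: int set). (-1) ^ nat \<bar>k\<bar> * q ^ nat (3 * k^2 - k)) \<and>
      1 / qpoch_inf q q *
          (\<Sum>\<^sub>\<infinity>k\<in>(UNIV :: int set). (-1) ^ nat \<bar>k\<bar> * q ^ nat (3 * k^2 - k)) =
        qpoch_inf (q^2) (q^2) / qpoch_inf q q \<and>
      qpoch_inf (q^2) (q^2) / qpoch_inf q q = qpoch_inf (- q) q)"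
  unfolding Let_def
  \<comment> \<open>\<open>/\<close> and \<open>div\<close> denote the same constant, so both
    conjuncts are direct instances; for \<open>fps_X\<close> the norm is
    \<open>1 / 2\<close>.\<close>
  by (intro conjI[OF _ allI[OF impI]] multiplicative_norm.qpoch_identity[OF multiplicative_norm_fps]
      multiplicative_norm.qpoch_identity[OF multiplicative_norm_complex]) (simp_all add: dist_fps_def)

end
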